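(* For all $n\ge2$ and $k\ge1$, the number of permutations of $[n]$ with exactly two cycles that cyclically avoid 3--2--1 and whose first cycle (in standard cycle form) has $k$ elements equals the number of Dyck paths of semilength $n$ whose first peak is at height $k+1$.
   Context: The standard cycle form writes each cycle starting with its smallest element and lists the cycles in decreasing order of their smallest elements; so the first cycle is the one with the larger minimum. $\Psi(\pi)$ is the word obtained by deleting the parentheses. $\pi$ cyclically avoids 3--2--1 if there are no indices $i<j<k$ with $\Psi(\pi)_i>\Psi(\pi)_j>\Psi(\pi)_k$. A Dyck path of semilength $n$ is a lattice path from $(0,0)$ to $(2n,0)$ with steps $(1,1)$, $(1,-1)$ never going below the $x$-axis; its first peak is the first up step immediately followed by a down step, and its height is the height reached by that up step. *)

theory Defs
  imports "HOL-Combinatorics.Cycles" "HOL-Combinatorics.Orbits"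
begin

section \<open>Standard cycle form and cyclic pattern avoidance\<close>

text \<open>For \<^term>\<open>p permutes {1..n}\<close>; fixed points count as cycles of length one.\<close>

definition cycle_sets :: "nat \<Rightarrow> (nat \<Rightarrow> nat) \<Rightarrow> nat set set" where
  "cycle_sets n p = orbit p ` {1..n}"

text \<open>\<^term>\<open>support p m\<close> is the list \<open>[m, p m, p (p m), \<dots>]\<close> running once through the
  cycle of \<open>m\<close>.\<close>

definition standard_cycle_form :: "nat \<Rightarrow> (nat \<Rightarrow> nat) \<Rightarrow> nat list list" where
  "standard_cycle_form n p =
     map (support p) (rev (sorted_list_of_set (Min ` cycle_sets n p)))"

definition Psi :: "nat \<Rightarrow> (nat \<Rightarrow> nat) \<Rightarrow> nat list" where
  "Psi n p = concat (standard_cycle_form n p)"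

definition cyclically_avoids_321 :: "nat \<Rightarrow> (nat \<Rightarrow> nat) \<Rightarrow> bool" where
  "cyclically_avoids_321 n p \<longleftrightarrow>
     \<not> (\<exists>i j k. i < j \<and> j < k \<and> k < length (Psi n p) \<and>
          Psi n p ! i > Psi n p ! j \<and> Psi n p ! j > Psi n p ! k)"

section \<open>Dyck paths\<close>

text \<open>A path from the origin is given by its steps \<open>(1, 1)\<close> and \<open>(1, -1)\<close>.\<close>

datatype step = Up | Down

fun rise :: "step \<Rightarrow> int" where
  "rise Up = 1"
| "rise Down = -1"

text \<open>The vertex of the path at abscissa \<open>i\<close> is \<open>(i, height w i)\<close>.\<close>

definition height :: "step list \<Rightarrow> nat \<Rightarrow> int" where
  "height w i = (\<Sum>j<i. rise (w ! j))"

definition dyck_path :: "nat \<Rightarrow> step list \<Rightarrow> bool" where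
  "dyck_path n w \<longleftrightarrow>
     length w = 2 * n \<and> height w (2 * n) = 0 \<and> (\<forall>i\<le>2 * n. height w i \<ge> 0)"

text \<open>Position (from 0) of the first up step immediately followed by a down step;
  meaningful for nonempty Dyck paths, which always have a peak.\<close>

definition first_peak :: "step list \<Rightarrow> nat" where
  "first_peak w = (LEAST i. Suc i < length w \<and> w ! i = Up \<and> w ! Suc i = Down)"

definition first_peak_height :: "step list \<Rightarrow> int" where
  "first_peak_height w = height w (Suc (first_peak w))"

end

(* An entry of Psi p before 1 that exceeded a later entry before 1 would form a 3-2-1 with 1.
   So a permutation with two cycles is cyclically 321-avoiding iff the word Psi p, with 1 deleted,
   avoids 3-2-1 and its first k entries (the first cycle) increase. Let A(X, k) count the
   321-avoiding words on the alphabet X whose first k entries increase. Such a word either has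
   k + 1 increasing initial entries or a descent after the k-th entry; in the latter case
   deleting the minimum of X, which must be the first entry or the one at the bottom of the
   descent, is a bijection onto the words counted by A(X - {min X}, k - 1). This is the recursion,
   by the first step, for the paths from height k down to 0 that follow the first peak of a
   Dyck path. *)

theory Submission
  imports Defs
begin

text \<open>The number of nonnegative paths from height \<open>h\<close> to height \<open>0\<close> with \<open>u\<close> up steps.\<close>

fun ballot :: "nat \<Rightarrow> nat \<Rightarrow> nat" where
  "ballot 0 h = 1"
| "ballot (Suc u) 0 = ballot u 1"
| "ballot (Suc u) (Suc h) = ballot u (Suc (Suc h)) + ballot (Suc u) h"

section \<open>Dyck paths with a given first peak\<close>

text \<open>The height still to be lost is carried along as a natural number, so a step below the
  axis is simply the false case \<open>Down\<close> at height 0. This describes what remains of a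
  Dyck path from height \<open>h\<close> on.\<close>

fun descends :: "nat \<Rightarrow> step list \<Rightarrow> bool" where
  "descends h [] \<longleftrightarrow> h = 0"
| "descends h (Up # w) \<longleftrightarrow> descends (Suc h) w"
| "descends 0 (Down # w) \<longleftrightarrow> False"
| "descends (Suc h) (Down # w) \<longleftrightarrow> descends h w"

lemma height_0 [simp]: "height w 0 = 0"
  by (simp add: height_def)

lemma height_Cons_Suc [simp]: "height (s # w) (Suc i) = rise s + height w i"
  by (simp add: height_def sum.lessThan_Suc_shift del: sum.lessThan_Suc)

lemma all_le_Suc_iff: "(\<forall>i\<le>Suc n. P i) \<longleftrightarrow> P 0 \<and> (\<forall>i\<le>n. P (Suc i))"
  by (metis Suc_le_mono le0 not0_implies_Suc)

lemma descends_iff_height: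
  "descends h w \<longleftrightarrow>
     int h + height w (length w) = 0 \<and> (\<forall>i\<le>length w. int h + height w i \<ge> 0)"
proof (induction h w rule: descends.induct)
  case (3 w)
  \<comment> \<open>A \<open>Down\<close> from height 0 reaches -1 at once; index 0 of the tail
    witnesses the violation.\<close>
  then show ?case by (auto simp: all_le_Suc_iff intro!: exI[of _ 0])
qed (auto simp: all_le_Suc_iff algebra_simps)

lemma dyck_path_iff_descends: "dyck_path n w \<longleftrightarrow> length w = 2 * n \<and> descends 0 w"
  unfolding dyck_path_def descends_iff_height by auto

lemma descends_length_ge: "descends h w \<Longrightarrow> h \<le> length w"
  by (induction h w rule: descends.induct) auto

lemma descends_replicate_Up [simp]: "descends h (replicate j Up @ w) \<longleftrightarrow> descends (h + j) w"
  by (induction j arbitrary: h) auto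

section \<open>Counting paths from a given height by their first step\<close>

lemma finite_step_lists: "finite {w :: step list. length w = l \<and> P w}"
proof -
  have "(UNIV :: step set) = {Up, Down}" using step.exhaust by auto
  then have "finite {w :: step list. set w \<subseteq> UNIV \<and> length w = l}"
    by (metis finite.emptyI finite_insert finite_lists_length_eq)
  then show ?thesis by (rule rev_finite_subset) auto
qed

lemma card_step_lists_Suc:
  "card {w. length w = Suc l \<and> P w} =
    card {w. length w = l \<and> P (Up # w)} + card {w. length w = l \<and> P (Down # w)}"
proof -
  let ?A = "\<lambda>s. {w. length w = l \<and> P (s # w)}"
  have "{w. length w = Suc l \<and> P w} = (#) Up ` ?A Up \<union> (#) Down ` ?A Down" (is "?L = ?R")
  proof (intro set_eqI)
    fix w show "w \<in> ?L \<longleftrightarrow> w \<in> ?R"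
    proof (cases w)
      case (Cons s v)
      then show ?thesis by (cases s) auto
    qed auto
  qed
  moreover have "(#) Up ` ?A Up \<inter> (#) Down ` ?A Down = {}" by auto
  ultimately show ?thesis
    by (simp add: card_Un_disjoint finite_step_lists card_image)
qed

text \<open>A path with \<open>u\<close> up steps from height \<open>h\<close> to 0 has
  \<open>u + h\<close> down steps, hence the length. Splitting off the first step turns the
  equations of \<open>descends\<close> into those of \<open>ballot\<close>.\<close>

lemma card_descends: "card {w. length w = 2 * u + h \<and> descends h w} = ballot u h"
proof (induction u h rule: ballot.induct)
  case (1 h)
  show ?case
  proof (induction h)
    case 0
    have "{w. length w = 0 \<and> descends 0 w} = {[]}" by auto
    then show ?case by simp
  next
    case (Suc h)
    \<comment> \<open>Starting with \<open>Up\<close> would leave \<open>h\<close> steps to descend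
      \<open>h + 2\<close>, so with no up steps to spend only the \<open>Down\<close> branch
      survives.\<close>
    have "{w. length w = h \<and> descends (Suc (Suc h)) w} = {}"
      using descends_length_ge by fastforce
    with Suc show ?case by (simp add: card_step_lists_Suc del: Collect_empty_eq)
  qed
next
  case (2 u)
  then show ?case by (simp add: card_step_lists_Suc)
next
  case (3 u h)
  then show ?case by (simp add: card_step_lists_Suc)
qed

section \<open>Splitting a Dyck path at its first peak\<close>

lemma descends_first_Down:
  assumes "descends h w" "h > 0 \<or> w \<noteq> []"
  shows "\<exists>j v. w = replicate j Up @ Down # v"
  using assms
proof (induction h w rule: descends.induct)
  case (2 h w)
  \<comment> \<open>After an \<open>Up\<close> the height is positive, so the tail meets the side
    condition of the induction hypothesis.\<close>
  then obtain j v where "w = replicate j Up @ Down # v" by auto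
  then have "Up # w = replicate (Suc j) Up @ Down # v" by simp
  then show ?case by blast
next
  case (4 h w)
  have "Down # w = replicate 0 Up @ Down # w" by simp
  then show ?case by blast
qed auto

lemma first_peak_replicate_Up: "first_peak (replicate (Suc j) Up @ Down # v) = j"
  unfolding first_peak_def
proof (rule Least_equality)
  fix i
  assume i: "Suc i < length (replicate (Suc j) Up @ Down # v) \<and>
    (replicate (Suc j) Up @ Down # v) ! i = Up \<and>
    (replicate (Suc j) Up @ Down # v) ! Suc i = Down"
  show "j \<le> i"
  proof (rule ccontr)
    assume "\<not> j \<le> i"
    then have "(replicate (Suc j) Up @ Down # v) ! Suc i = Up"
      by (simp add: nth_append del: replicate_Suc)
    with i show False by simp
  qed
qed (auto simp: nth_append simp del: replicate_Suc)

lemma height_replicate_Up: "height (replicate j Up @ w) j = int j"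
  by (induction j) auto

lemma first_peak_height_replicate_Up:
  "first_peak_height (replicate (Suc j) Up @ Down # v) = int (Suc j)"
  unfolding first_peak_height_def first_peak_replicate_Up by (rule height_replicate_Up)

text \<open>A nonempty Dyck path is an initial run of up steps, a \<open>Down\<close>, and an
  arbitrary rest; the run has the height of the first peak as its length, so the rest starts at
  height \<open>k\<close>.\<close>

lemma dyck_paths_first_peak_height:
  assumes "n > 0"
  shows "{w. dyck_path n w \<and> first_peak_height w = int (Suc k)} =
    (\<lambda>v. replicate (Suc k) Up @ Down # v) ` {v. Suc (Suc (k + length v)) = 2 * n \<and> descends k v}"
    (is "?L = ?R")
proof
  show "?R \<subseteq> ?L"
    by (auto simp: dyck_path_iff_descends first_peak_height_replicate_Up simp del: replicate_Suc)
next
  show "?L \<subseteq> ?R"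
  proof
    fix w assume w: "w \<in> ?L"
    then have desc: "length w = 2 * n" "descends 0 w"
      by (auto simp: dyck_path_iff_descends)
    with assms obtain j v where jv: "w = replicate j Up @ Down # v"
      using descends_first_Down[of 0 w] by force
    \<comment> \<open>The run is nonempty, since a path on the axis cannot begin with
      \<open>Down\<close>.\<close>
    with desc obtain i where i: "j = Suc i" by (cases j) auto
    with w jv have "i = k" using first_peak_height_replicate_Up by fastforce
    then show "w \<in> ?R" using jv desc i by (auto simp del: replicate_Suc)
  qed
qed

text \<open>The rest has length \<open>2 * n - k - 2\<close>. For \<open>k < n\<close> this is
  \<open>2 * (n - Suc k) + k\<close>, which leaves \<open>n - Suc k\<close> up steps; otherwise it
  is too short to descend from height \<open>k\<close>.\<close>

theorem card_dyck_paths_first_peak_height: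
  assumes "n > 0"
  shows "card {w. dyck_path n w \<and> first_peak_height w = int (Suc k)} =
    (if k < n then ballot (n - Suc k) k else 0)"
proof -
  have "card {w. dyck_path n w \<and> first_peak_height w = int (Suc k)} =
      card {v. Suc (Suc (k + length v)) = 2 * n \<and> descends k v}"
    unfolding dyck_paths_first_peak_height[OF assms] by (rule card_image) (simp add: inj_on_def)
  also have "\<dots> = (if k < n then ballot (n - Suc k) k else 0)"
  proof (cases "k < n")
    case True
    then have "{v. Suc (Suc (k + length v)) = 2 * n \<and> descends k v} =
        {v. length v = 2 * (n - Suc k) + k \<and> descends k v}"
      by auto
    with True show ?thesis by (simp add: card_descends)
  next
    case False
    then have "{v. Suc (Suc (k + length v)) = 2 * n \<and> descends k v} = {}"
      using descends_length_ge[of k] by fastforce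
    with False show ?thesis by (simp only: card.empty if_False)
  qed
  finally show ?thesis .
qed

section \<open>Words avoiding 3--2--1\<close>

text \<open>A letter \<open>x\<close> is the top of a 3-2-1 iff two of the later letters below
  \<open>x\<close> stand in decreasing order.\<close>

fun avoids_321 :: "nat list \<Rightarrow> bool" where
  "avoids_321 [] \<longleftrightarrow> True"
| "avoids_321 (x # xs) \<longleftrightarrow> sorted (filter (\<lambda>y. y < x) xs) \<and> avoids_321 xs"

lemma sorted_filter_iff: "sorted (filter P xs) \<longleftrightarrow> sorted_wrt (\<lambda>y z. P y \<longrightarrow> P z \<longrightarrow> y \<le> z) xs"
  by (induction xs) auto

text \<open>Each occurrence either has its top at the head or lies wholly in the tail. This connects
  the recursion with the positional form used for \<open>Psi\<close>.\<close>

lemma avoids_321_iff_nth: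
  "avoids_321 w \<longleftrightarrow>
     \<not> (\<exists>i j k. i < j \<and> j < k \<and> k < length w \<and> w ! i > w ! j \<and> w ! j > w ! k)"
proof (induction w)
  case (Cons x xs)
  let ?d = "\<lambda>w i j k. i < j \<and> j < k \<and> k < length w \<and> w ! i > w ! j \<and> w ! j > (w ! k :: nat)"
  have "(\<exists>i j k. ?d (x # xs) i j k) \<longleftrightarrow>
      (\<exists>j k. j < k \<and> k < length xs \<and> x > xs ! j \<and> xs ! j > xs ! k) \<or> (\<exists>i j k. ?d xs i j k)"
    (is "?l \<longleftrightarrow> ?r")
  proof
    assume ?l
    then obtain i j k where d: "?d (x # xs) i j k" by blast
    then obtain j' k' where jk: "j = Suc j'" "k = Suc k'"
      by (cases j; cases k) auto
    show ?r
    proof (cases i)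
      case 0
      with d jk show ?thesis by auto
    next
      case (Suc i')
      with d jk have "?d xs i' j' k'" by simp
      then show ?thesis by blast
    qed
  next
    assume ?r
    then consider j k where "j < k" "k < length xs" "x > xs ! j" "xs ! j > xs ! k"
      | i j k where "?d xs i j k" by blast
    then show ?l
    proof cases
      case 1
      then have "?d (x # xs) 0 (Suc j) (Suc k)" by simp
      then show ?thesis by blast
    next
      case 2
      then have "?d (x # xs) (Suc i) (Suc j) (Suc k)" by simp
      then show ?thesis by blast
    qed
  qed
  moreover have "sorted (filter (\<lambda>y. y < x) xs) \<longleftrightarrow>
      \<not> (\<exists>j k. j < k \<and> k < length xs \<and> x > xs ! j \<and> xs ! j > xs ! k)"
    unfolding sorted_filter_iff unfolding sorted_wrt_iff_nth_less by (smt (verit) not_less order.strict_trans)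
  ultimately show ?case by (simp only: avoids_321.simps Cons.IH de_Morgan_disj)
qed simp

text \<open>The smallest letter \<open>a\<close> can only be the 1 of a pattern, so the patterns it
  creates come from the decreasing pairs inside \<open>xs\<close>. The lemma serves both the
  deletion of a minimum and the removal of 1 from \<open>Psi\<close>.\<close>

lemma avoids_321_insert_min:
  assumes "\<forall>x\<in>set xs \<union> set ys. a < x"
  shows "avoids_321 (xs @ a # ys) \<longleftrightarrow> sorted xs \<and> avoids_321 (xs @ ys)"
  using assms
proof (induction xs)
  case Nil
  then have "filter (\<lambda>y. y < a) ys = []" by (auto simp: filter_empty_conv)
  then show ?case by simp
next
  case (Cons x xs)
  \<comment> \<open>The letter \<open>a\<close> passes the filter and is the least to do so, hence
    nothing may precede it in the filtered list.\<close>
  have "sorted (filter (\<lambda>y. y < x) (xs @ a # ys)) \<longleftrightarrow>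
      (\<forall>y\<in>set xs. x \<le> y) \<and> sorted (filter (\<lambda>y. y < x) ys)"
  proof -
    have empty: "(\<forall>y\<in>set xs. x \<le> y) \<longleftrightarrow> filter (\<lambda>y. y < x) xs = []"
      by (auto simp: filter_empty_conv)
    have sorted_mid: "sorted (us @ a # vs) \<longleftrightarrow> us = [] \<and> sorted vs"
      if "\<forall>y\<in>set us \<union> set vs. a < y" for us vs
      using that by (cases us) (auto simp: sorted_append less_imp_le)
    have "sorted (filter (\<lambda>y. y < x) xs @ a # filter (\<lambda>y. y < x) ys) \<longleftrightarrow>
        filter (\<lambda>y. y < x) xs = [] \<and> sorted (filter (\<lambda>y. y < x) ys)"
      by (rule sorted_mid) (use Cons.prems in auto)
    moreover have "filter (\<lambda>y. y < x) (xs @ a # ys) =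
        filter (\<lambda>y. y < x) xs @ a # filter (\<lambda>y. y < x) ys"
      using Cons.prems by simp
    ultimately show ?thesis by (simp only: empty)
  qed
  moreover have "(\<forall>y\<in>set xs. x \<le> y) \<Longrightarrow> filter (\<lambda>y. y < x) xs = []"
    by (auto simp: filter_empty_conv)
  ultimately show ?case using Cons by auto
qed

section \<open>Words with an increasing prefix, and deletion of the minimum\<close>

definition avoiders :: "nat set \<Rightarrow> nat \<Rightarrow> nat list set" where
  "avoiders X k = {w. distinct w \<and> set w = X \<and> avoids_321 w \<and> sorted (take k w)}"

lemma avoidersD:
  assumes "w \<in> avoiders X k"
  shows "distinct w" "set w = X" "avoids_321 w" "sorted (take k w)" "length w = card X"
  using assms distinct_card[of w] by (auto simp: avoiders_def)

lemma finite_avoiders: "finite X \<Longrightarrow> finite (avoiders X k)"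
  by (rule finite_subset[OF _ finite_subset_distinct[of X]]) (auto simp: avoiders_def)

lemma avoids_321_sorted: "sorted w \<Longrightarrow> avoids_321 w"
  by (induction w) (auto simp: sorted_wrt_filter)

text \<open>The prefix is the whole word, and an increasing word contains no pattern. This is the
  base case of the count.\<close>

lemma avoiders_card_le:
  assumes "finite X" "card X \<le> k"
  shows "avoiders X k = {sorted_list_of_set X}"
proof -
  have "w \<in> avoiders X k \<longleftrightarrow> w = sorted_list_of_set X" for w
  proof -
    have "w \<in> avoiders X k \<longleftrightarrow> sorted w \<and> distinct w \<and> set w = X"
      using assms distinct_card[of w] avoids_321_sorted[of w]
      by (auto simp: avoiders_def sorted_wrt_take)
    then show ?thesis
      using assms sorted_list_of_set.idem_if_sorted_distinct[of w] by auto
  qed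
  then show ?thesis by auto
qed

text \<open>For positive \<open>k\<close>, the words lost in passing to \<open>Suc k\<close> are
  those with a descent right after entry \<open>k\<close>.\<close>

lemma avoiders_Suc_subset: "avoiders X (Suc k) \<subseteq> avoiders X k"
proof -
  have "sorted (take (Suc k) w) \<Longrightarrow> sorted (take k w)" for w :: "nat list"
    using sorted_wrt_take[of "(\<le>)" "take (Suc k) w" k] by simp
  then show ?thesis by (auto simp: avoiders_def)
qed

text \<open>If \<open>a\<close> is the bottom of the descent, deleting it leaves \<open>k\<close>
  increasing initial entries. If \<open>a\<close> comes first, deleting it moves the descent one
  place forward, so only \<open>k - 1\<close> initial entries increase. Testing
  \<open>sorted (take k v)\<close> therefore tells the inverse where to reinsert
  \<open>a\<close>.\<close>

lemma bij_betw_delete_min: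
  assumes "finite X" "\<forall>x\<in>X. a < x" "k \<le> card X" "0 < k"
  shows "bij_betw (remove1 a) (avoiders (insert a X) k - avoiders (insert a X) (Suc k))
    (avoiders X (k - 1))"
proof (rule bij_betw_byWitness[where f' =
      "\<lambda>v. if sorted (take k v) then take k v @ a # drop k v else a # v"])
  have "a \<notin> X" using assms by auto
  let ?E = "avoiders (insert a X) k - avoiders (insert a X) (Suc k)"
  \<comment> \<open>Every word with a descent after entry \<open>k\<close> arises from one of the
    two insertions.\<close>
  have E: "\<exists>v. v \<in> avoiders X (k - 1) \<and>
      (w = a # v \<and> \<not> sorted (take k v) \<or> w = take k v @ a # drop k v \<and> sorted (take k v))"
    if "w \<in> ?E" for w
  proof -
    have w: "w \<in> avoiders (insert a X) k" using that by simp
    note w = avoidersD[OF this]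
    have nsorted: "\<not> sorted (take (Suc k) w)" using that by (auto simp: avoiders_def)
    from w(2) obtain ys zs where yz: "w = ys @ a # zs" using split_list[of a w] by auto
    have X: "set (ys @ zs) = X" using w(1,2) \<open>a \<notin> X\<close> yz by auto
    then have a: "\<forall>x\<in>set ys \<union> set zs. a < x" using assms(2) by auto
    have yz_av: "sorted ys" "avoids_321 (ys @ zs)"
      using avoids_321_insert_min[OF a] w(3) yz by auto
    show ?thesis
    proof (cases "ys = []")
      case True
      then have "take k w = a # take (k - 1) zs" "take (Suc k) w = a # take k zs"
        using yz assms(4) by (cases k; simp)+
      moreover have "\<forall>x\<in>set (take k zs). a \<le> x"
        using a by (meson UnI2 in_set_takeD less_imp_le)
      ultimately have "sorted (take (k - 1) zs)" "\<not> sorted (take k zs)"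
        using w(4) nsorted by auto
      then show ?thesis using True yz w yz_av X by (auto simp: avoiders_def)
    next
      case False
      \<comment> \<open>With \<open>a\<close> inside the increasing prefix, the letters before it
        would be at most \<open>a\<close>.\<close>
      have "\<not> length ys < k"
      proof
        assume "length ys < k"
        then have "take k w = ys @ a # take (k - length ys - 1) zs"
          using yz by (simp add: take_Cons')
        with w(4) have "\<forall>y\<in>set ys. y \<le> a" by (auto simp: sorted_append)
        with a False show False by (metis UnI1 leD list.set_intros(1) neq_Nil_conv)
      qed
      \<comment> \<open>With \<open>a\<close> further right, the first \<open>k + 1\<close> entries
        would lie in \<open>ys\<close>, which increases because \<open>a\<close> follows it.\<close>
      moreover have "\<not> k < length ys"
      proof
        assume "k < length ys"
        then have "take (Suc k) w = take (Suc k) ys" using yz by simp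
        with nsorted yz_av(1) show False by (simp add: sorted_wrt_take)
      qed
      ultimately have len: "length ys = k" by simp
      then have "ys @ zs \<in> avoiders X (k - 1)"
        using w yz_av X yz by (auto simp: avoiders_def sorted_wrt_take)
      then show ?thesis using len yz yz_av(1) by (intro exI[of _ "ys @ zs"]) auto
    qed
  qed
  have nota: "a \<notin> set v" if "v \<in> avoiders X (k - 1)" for v
    using avoidersD(2)[OF that] \<open>a \<notin> X\<close> by simp
  have remove: "remove1 a (take k v @ a # drop k v) = v" if "v \<in> avoiders X (k - 1)" for v
    using nota[OF that] in_set_takeD[of a k v] by (auto simp: remove1_append)
  have E': "remove1 a w \<in> avoiders X (k - 1) \<and> (if sorted (take k (remove1 a w))
      then take k (remove1 a w) @ a # drop k (remove1 a w) else a # remove1 a w) = w"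
    if w: "w \<in> ?E" for w
  proof -
    from E[OF w] obtain v where v: "v \<in> avoiders X (k - 1)"
      and "w = a # v \<and> \<not> sorted (take k v) \<or> w = take k v @ a # drop k v \<and> sorted (take k v)"
      by blast
    from this(2) show ?thesis
    proof (elim disjE conjE)
      assume "w = a # v" "\<not> sorted (take k v)"
      with v show ?thesis by simp
    next
      assume w: "w = take k v @ a # drop k v" "sorted (take k v)"
      have "remove1 a w = v" unfolding w(1) by (rule remove[OF v])
      with v w show ?thesis by simp
    qed
  qed
  then show "\<forall>w\<in>?E. (if sorted (take k (remove1 a w))
      then take k (remove1 a w) @ a # drop k (remove1 a w) else a # remove1 a w) = w"
    by blast
  from E' show "remove1 a ` ?E \<subseteq> avoiders X (k - 1)" by blast
  show "\<forall>v\<in>avoiders X (k - 1).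
      remove1 a (if sorted (take k v) then take k v @ a # drop k v else a # v) = v"
    using remove by auto
  show "(\<lambda>v. if sorted (take k v) then take k v @ a # drop k v else a # v) `
      avoiders X (k - 1) \<subseteq> ?E"
  proof (rule image_subsetI)
    fix v assume "v \<in> avoiders X (k - 1)"
    note v = avoidersD[OF this] and nota = nota[OF this]
    have gt: "\<forall>x\<in>set v. a < x" using v(2) assms(2) by auto
    show "(if sorted (take k v) then take k v @ a # drop k v else a # v) \<in> ?E"
    proof (cases "sorted (take k v)")
      case True
      let ?w = "take k v @ a # drop k v"
      have len: "length (take k v) = k" using v(5) assms(3) by simp
      \<comment> \<open>The inserted word rearranges \<open>a # v\<close>; the multiset carries over
        its letters and its distinctness.\<close>
      have "mset v = mset (take k v) + mset (drop k v)"
        by (metis append_take_drop_id mset_append)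
      then have mset: "mset ?w = mset (a # v)" by simp
      have set: "set ?w = insert a (set v)" using mset_eq_setD[OF mset] by simp
      have "distinct ?w" using mset_eq_imp_distinct_iff[OF mset] v(1) nota by simp
      moreover have "avoids_321 ?w"
        using gt v(3) True by (subst avoids_321_insert_min) (auto dest: in_set_takeD in_set_dropD)
      moreover have "take (Suc k) ?w = take k v @ [a]" using len by simp
      \<comment> \<open>As \<open>k\<close> is positive, some letter larger than \<open>a\<close>
        precedes it.\<close>
      moreover have "\<not> sorted (take k v @ [a])"
      proof
        assume s: "sorted (take k v @ [a])"
        obtain x where "x \<in> set (take k v)" using len assms(4) by (metis length_greater_0_conv nth_mem)
        with s gt show False by (metis in_set_takeD leD list.set_intros(1) sorted_wrt_append)
      qed
      moreover have "take k ?w = take k v" using len by simp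
      ultimately show ?thesis using True set v(2) by (simp add: avoiders_def)
    next
      case False
      have "take k (a # v) = a # take (k - 1) v" using assms(4) by (cases k) auto
      moreover have "avoids_321 (a # v)"
        using avoids_321_insert_min[of "[]" v a] gt v(3) by simp
      ultimately show ?thesis using False v nota gt
        by (auto simp: avoiders_def dest!: in_set_takeD)
    qed
  qed
qed

text \<open>Here \<open>u\<close> is the number of letters beyond the prefix. Lengthening the prefix
  uses up one of them, like an up step; deleting the minimum shortens the prefix by one, like a down
  step.\<close>

theorem card_avoiders:
  assumes "finite X" "card X = u + k"
  shows "card (avoiders X k) = ballot u k"
  using assms
proof (induction u k arbitrary: X rule: ballot.induct)
  case (1 h)
  then show ?case by (simp add: avoiders_card_le)
next
  case (2 u)
  \<comment> \<open>Prefixes of length 0 and 1 impose the same condition, matching the forced up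
    step at height 0.\<close>
  have "sorted (take 1 w)" for w :: "nat list" by (cases w) auto
  then have "avoiders X 0 = avoiders X 1" by (simp add: avoiders_def)
  then show ?case using 2 by simp
next
  case (3 u h)
  define a where "a = Min X"
  define Y where "Y = X - {a}"
  have "X \<noteq> {}" using "3.prems" by auto
  then have "a \<in> X" using "3.prems"(1) unfolding a_def by simp
  then have X: "X = insert a Y" "finite Y" and cY: "card Y = Suc u + h"
    using "3.prems" by (auto simp: Y_def)
  have less: "\<forall>y\<in>Y. a < y"
    using "3.prems"(1) by (auto simp: Y_def a_def less_le)
  have "card (avoiders X (Suc h) - avoiders X (Suc (Suc h))) = card (avoiders Y h)"
    using bij_betw_same_card[OF bij_betw_delete_min[OF X(2) less, of "Suc h"]] cY X(1) by simp
  also have "\<dots> = ballot (Suc u) h" using "3.IH"(2) X(2) cY .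
  finally have "card (avoiders X (Suc h) - avoiders X (Suc (Suc h))) = ballot (Suc u) h" .
  moreover have "card (avoiders X (Suc (Suc h))) = ballot u (Suc (Suc h))"
    using "3.IH"(1) "3.prems" by simp
  moreover have "card (avoiders X (Suc h)) =
      card (avoiders X (Suc (Suc h))) + card (avoiders X (Suc h) - avoiders X (Suc (Suc h)))"
    using avoiders_Suc_subset[of X "Suc h"] finite_avoiders[OF "3.prems"(1)]
    by (metis card_Diff_subset card_mono le_add_diff_inverse)
  ultimately show ?case by simp
qed

section \<open>Permutations with two cycles\<close>

lemma orbit_eq_set_support: "permutation p \<Longrightarrow> orbit p x = set (support p x)"
  unfolding support_set by (auto simp: orbit_altdef_permutation)

lemma orbit_eq_if_mem: "permutation p \<Longrightarrow> y \<in> orbit p x \<Longrightarrow> orbit p y = orbit p x"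
  using orbit_cyclic_eq3[OF cyclic_on_orbit'] by fastforce

text \<open>The powers of \<open>p\<close> walk cyclically through \<open>cs\<close>, and
  distinctness makes \<open>length cs\<close> the first return time.\<close>

lemma support_hd_eq:
  assumes "distinct cs" "cs \<noteq> []" and p: "\<And>x. x \<in> set cs \<Longrightarrow> p x = cycle_of_list cs x"
  shows "support p (hd cs) = cs"
proof -
  let ?l = "length cs"
  \<comment> \<open>Applying the cycle to all its entries rotates the list by one place.\<close>
  have step: "cycle_of_list cs (cs ! j) = cs ! (Suc j mod ?l)" if "j < ?l" for j
  proof -
    have "map (cycle_of_list cs) cs = rotate1 cs"
      using cyclic_rotation[OF assms(1), of 1] by simp
    then have "map (cycle_of_list cs) cs ! j = rotate1 cs ! j" by simp
    with that show ?thesis by (simp add: nth_rotate1)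
  qed
  have pow: "(p ^^ i) (hd cs) = cs ! (i mod ?l)" for i
  proof (induction i)
    case 0
    then show ?case using assms(2) by (simp add: hd_conv_nth)
  next
    case (Suc i)
    have "i mod ?l < ?l" using assms(2) by simp
    then show ?case using Suc p step by (simp add: mod_Suc_eq)
  qed
  have fix_iff: "(p ^^ i) (hd cs) = hd cs \<longleftrightarrow> ?l dvd i" for i
    unfolding pow using assms(1,2) by (simp add: hd_conv_nth nth_eq_iff_index_eq dvd_eq_mod_eq_0)
  have "least_power p (hd cs) = ?l"
    unfolding least_power_def fix_iff
    using assms(2) by (intro Least_equality) (auto dest: dvd_imp_le)
  then show ?thesis by (intro nth_equalityI) (auto simp: pow)
qed

lemma standard_cycle_form_two:
  assumes "cycle_sets n p = {A, B}" "Min B < Min A"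
  shows "standard_cycle_form n p = [support p (Min A), support p (Min B)]"
proof -
  have "sorted_list_of_set {Min A, Min B} = [Min B, Min A]"
    using sorted_list_of_set.idem_if_sorted_distinct[of "[Min B, Min A]"] assms(2)
    by (simp add: insert_commute)
  then show ?thesis unfolding standard_cycle_form_def assms(1) by simp
qed

text \<open>Since \<open>xs\<close> is sorted, its head is its minimum, so the standard form returns
  \<open>xs\<close> itself and not a rotation. The other cycle starts with 1, the least element of
  all, and so comes last.\<close>

lemma two_cycles_of_words:
  fixes xs ys :: "nat list"
  assumes "distinct (xs @ 1 # ys)" "set (xs @ 1 # ys) = {1..n}" "xs \<noteq> []" "sorted xs"
  defines "p \<equiv> cycle_of_list xs \<circ> cycle_of_list (1 # ys)"
  shows "p permutes {1..n}" "card (cycle_sets n p) = 2"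
    "standard_cycle_form n p = [xs, 1 # ys]"
proof -
  let ?ys = "1 # ys"
  have sub: "set xs \<subseteq> {1..n}" "set ?ys \<subseteq> {1..n}" and disj: "set xs \<inter> set ?ys = {}"
    and un: "{1..n} = set xs \<union> set ?ys"
    using assms(1,2) by auto
  show perm: "p permutes {1..n}"
    unfolding p_def
    by (rule permutes_compose; rule permutes_subset[OF cycle_permutes]) (rule sub)+
  then have permutation: "permutation p" using permutation_permutes by blast
  have p_xs: "p x = cycle_of_list xs x" if "x \<in> set xs" for x
  proof -
    have "x \<notin> set ?ys" using that disj by blast
    then show ?thesis using id_outside_supp[of x ?ys] by (simp add: p_def del: cycle_of_list.simps)
  qed
  have p_ys: "p x = cycle_of_list ?ys x" if "x \<in> set ?ys" for x
  proof -
    \<comment> \<open>The second cycle acts first and keeps its own elements, which the first cycle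
      then fixes.\<close>
    have "cycle_of_list ?ys x \<in> set ?ys"
      using permutes_in_image[OF cycle_permutes[of ?ys], of x] that by (simp only:)
    then have "cycle_of_list ?ys x \<notin> set xs" using disj by blast
    then show ?thesis unfolding p_def comp_apply by (rule id_outside_supp)
  qed
  have supp: "support p (hd xs) = xs" "support p 1 = ?ys"
    using support_hd_eq[of xs p] support_hd_eq[of ?ys p] p_xs p_ys assms(1,3)
    by (auto simp del: cycle_of_list.simps)
  have orbit_xs: "orbit p x = set xs" if "x \<in> set xs" for x
    using orbit_eq_if_mem[OF permutation, of x "hd xs"] that
    unfolding orbit_eq_set_support[OF permutation, of "hd xs"] supp by blast
  have orbit_ys: "orbit p x = set ?ys" if "x \<in> set ?ys" for x
    using orbit_eq_if_mem[OF permutation, of x 1] that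
    unfolding orbit_eq_set_support[OF permutation, of 1] supp by blast
  have "orbit p ` set xs = {set xs}" using orbit_xs assms(3) by (simp add: image_constant_conv)
  moreover have "orbit p ` set ?ys = {set ?ys}"
    using orbit_ys by (metis (no_types, lifting) image_cong image_constant list.set_intros(1))
  ultimately have sets: "cycle_sets n p = {set xs, set ?ys}"
    unfolding cycle_sets_def un image_Un by (metis insert_is_Un)
  moreover have "set xs \<noteq> set ?ys" using disj by auto
  ultimately show "card (cycle_sets n p) = 2" by simp
  have Min_ys: "Min (set ?ys) = 1"
    using sub(2) by (intro Min_eqI) auto
  have Min_xs: "Min (set xs) = hd xs"
    using assms(3,4) by (cases xs) (auto intro!: Min_eqI)
  have "1 < hd xs"
    using sub(1) disj assms(3) hd_in_set[of xs] by (metis One_nat_def Suc_lessI atLeastAtMost_iff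
        disjoint_iff list.set_intros(1) not_less_eq_eq less_Suc_eq_le le_neq_implies_less subsetD)
  then show "standard_cycle_form n p = [xs, ?ys]"
    using standard_cycle_form_two[OF sets] Min_xs Min_ys supp by simp
qed

lemma card_2_memE:
  assumes "b \<in> S" "card S = 2"
  obtains a where "S = {a, b}" "a \<noteq> b"
proof -
  have "card (S - {b}) = 1" using assms by simp
  then obtain a where "S - {b} = {a}" by (rule card_1_singletonE)
  with assms(1) have "S = {a, b}" "a \<noteq> b" by auto
  with that show ?thesis .
qed

text \<open>The cycle of 1 has the smallest minimum, so it is listed last and written from 1;
  \<open>p\<close> is the product of its two disjoint cycles.\<close>

lemma words_of_two_cycles:
  assumes "p permutes {1..n}" "card (cycle_sets n p) = 2"
  obtains xs ys where "standard_cycle_form n p = [xs, 1 # ys]"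
    "distinct (xs @ 1 # ys)" "set (xs @ 1 # ys) = {1..n}"
    "p = cycle_of_list xs \<circ> cycle_of_list (1 # ys)"
proof -
  have permutation: "permutation p" using assms(1) permutation_permutes by blast
  note orbit = orbit_eq_set_support[OF permutation]
  note self = permutation_self_in_orbit[OF permutation]
  from assms(2) have "{1..n} \<noteq> {}" unfolding cycle_sets_def by (metis card.empty image_empty
        zero_neq_numeral)
  then have one: "1 \<in> {1..n}" by simp
  let ?B = "orbit p 1"
  have "?B \<in> cycle_sets n p" using one by (simp add: cycle_sets_def)
  then obtain A where A: "cycle_sets n p = {A, ?B}" "A \<noteq> ?B"
    using assms(2) by (elim card_2_memE)
  then obtain a where a: "A = orbit p a" "a \<in> {1..n}" unfolding cycle_sets_def by blast
  have sub: "A \<subseteq> {1..n}" "?B \<subseteq> {1..n}"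
    using permutes_orbit_subset[OF assms(1)] a one by blast+
  have un: "A \<union> ?B = {1..n}"
  proof -
    have "{1..n} \<subseteq> \<Union> (cycle_sets n p)" using self by (auto simp: cycle_sets_def)
    then have "{1..n} \<subseteq> A \<union> ?B" unfolding A(1) by simp
    with sub show ?thesis by blast
  qed
  have disj: "A \<inter> ?B = {}"
    using orbit_eq_if_mem[OF permutation] A(2) a(1) by blast
  let ?m = "Min A"
  have "finite A" "A \<noteq> {}" using a self by (auto simp: finite_orbit)
  then have m: "?m \<in> A" by simp
  then have orbit_m: "orbit p ?m = A" using orbit_eq_if_mem[OF permutation] a(1) by blast
  have Min_B: "Min ?B = 1"
    using sub(2) self[of 1] finite_orbit[OF self] by (intro Min_eqI) auto
  have "1 < ?m" using m sub(1) disj self[of 1]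
    by (metis atLeastAtMost_iff disjoint_iff le_neq_implies_less subsetD)
  then have form: "standard_cycle_form n p = [support p ?m, support p 1]"
    using standard_cycle_form_two[OF A(1)] Min_B by simp
  obtain ys where ys: "support p 1 = 1 # ys"
    using least_power_of_permutation(2)[OF permutation, of 1]
    by (metis (no_types, lifting) funpow_0 list.simps(9) upt_conv_Cons)
  have sets: "set (support p ?m) = A" "set (support p 1) = ?B"
    using orbit orbit_m by simp_all
  \<comment> \<open>The two sides are compared on the cycle of 1, on \<open>A\<close>, and outside
    \<open>{1..n}\<close>, where both are the identity.\<close>
  have "p x = (cycle_of_list (support p ?m) \<circ> cycle_of_list (support p 1)) x" for x
  proof (cases "x \<in> ?B")
    case True
    then have "p x = cycle_of_list (support p 1) x"
      using cycle_restrict[OF permutation] sets by metis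
    moreover have "p x \<in> ?B" using True by (rule orbit.step)
    then have "cycle_of_list (support p ?m) (p x) = p x"
      using id_outside_supp sets disj by (metis disjoint_iff)
    ultimately show ?thesis by (metis comp_apply)
  next
    case False
    then have B: "cycle_of_list (support p 1) x = x" using id_outside_supp sets by metis
    have "p x = cycle_of_list (support p ?m) x"
    proof (cases "x \<in> A")
      case True
      then show ?thesis using cycle_restrict[OF permutation] sets by metis
    next
      case False': False
      then have "x \<notin> {1..n}" using un False by blast
      then have "p x = x" using assms(1) by (simp add: permutes_def)
      moreover have "cycle_of_list (support p ?m) x = x"
        using id_outside_supp sets False' by metis
      ultimately show ?thesis by metis
    qed
    with B show ?thesis by (metis comp_apply)
  qed
  then have "p = cycle_of_list (support p ?m) \<circ> cycle_of_list (support p 1)" by (rule ext)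
  moreover have "distinct (support p ?m @ support p 1)"
    unfolding distinct_append sets using cycle_of_permutation[OF permutation] disj by blast
  moreover have "set (support p ?m @ support p 1) = {1..n}"
    unfolding set_append sets by (rule un)
  ultimately show ?thesis using that form unfolding ys by blast
qed

section \<open>The bijection with words on \<open>{2..n}\<close> and the final count\<close>

abbreviation two_cycle_avoiders :: "nat \<Rightarrow> nat \<Rightarrow> (nat \<Rightarrow> nat) set" where
  "two_cycle_avoiders n k \<equiv>
    {p. p permutes {1..n} \<and> card (cycle_sets n p) = 2 \<and> cyclically_avoids_321 n p \<and>
      length (hd (standard_cycle_form n p)) = k}"

lemma cyclically_avoids_321_iff: "cyclically_avoids_321 n p \<longleftrightarrow> avoids_321 (Psi n p)"
  by (simp add: cyclically_avoids_321_def avoids_321_iff_nth)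

text \<open>All other letters exceed 1, so \<open>avoids_321_insert_min\<close> with
  \<open>a = 1\<close> splits avoidance by \<open>Psi n p\<close> into an increasing first cycle and
  avoidance by the remaining word.\<close>

lemma two_cycle_avoidersE:
  assumes "p \<in> two_cycle_avoiders n k"
  obtains xs ys where "Psi n p = xs @ 1 # ys" "length xs = k"
    "distinct (xs @ 1 # ys)" "set (xs @ 1 # ys) = {1..n}"
    "sorted xs" "avoids_321 (xs @ ys)"
    "p = cycle_of_list xs \<circ> cycle_of_list (1 # ys)"
proof -
  from assms have p: "p permutes {1..n}" "card (cycle_sets n p) = 2" "avoids_321 (Psi n p)"
      "length (hd (standard_cycle_form n p)) = k"
    by (auto simp: cyclically_avoids_321_iff)
  from words_of_two_cycles[OF p(1,2)] obtain xs ys where w: "standard_cycle_form n p = [xs, 1 # ys]"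
    "distinct (xs @ 1 # ys)" "set (xs @ 1 # ys) = {1..n}"
    "p = cycle_of_list xs \<circ> cycle_of_list (1 # ys)" .
  have Psi: "Psi n p = xs @ 1 # ys" by (simp add: Psi_def w(1))
  have "1 < x" if "x \<in> set xs \<union> set ys" for x
  proof -
    have "x \<noteq> 1" using that w(2) by auto
    moreover have "x \<in> {1..n}" using that w(3) by auto
    ultimately show ?thesis by simp
  qed
  then have "sorted xs \<and> avoids_321 (xs @ ys)"
    using p(3) avoids_321_insert_min[of xs ys 1] unfolding Psi by blast
  then show ?thesis using that[OF Psi _ w(2,3) _ _ w(4)] p(4) w(1) by simp
qed

text \<open>The length \<open>k\<close> of the first cycle records where 1 stood, so cutting the
  word after \<open>k\<close> letters recovers both cycles. The bounds on \<open>k\<close> make the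
  first part a nonempty list of exactly \<open>k\<close> letters.\<close>

lemma bij_betw_two_cycle_avoiders:
  assumes "0 < k" "k < n"
  shows "bij_betw (\<lambda>p. remove1 1 (Psi n p)) (two_cycle_avoiders n k) (avoiders {2..n} k)"
proof (rule bij_betw_byWitness[where f' =
      "\<lambda>v. cycle_of_list (take k v) \<circ> cycle_of_list (1 # drop k v)"])
  have interval: "{1..n} = insert 1 {2..n}" using assms by auto
  have fwd: "remove1 1 (Psi n p) \<in> avoiders {2..n} k \<and>
      cycle_of_list (take k (remove1 1 (Psi n p))) \<circ>
        cycle_of_list (1 # drop k (remove1 1 (Psi n p))) = p"
    if p: "p \<in> two_cycle_avoiders n k" for p
  proof -
    from p obtain xs ys where w: "Psi n p = xs @ 1 # ys" "length xs = k"
      "distinct (xs @ 1 # ys)" "set (xs @ 1 # ys) = {1..n}" "sorted xs" "avoids_321 (xs @ ys)"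
      "p = cycle_of_list xs \<circ> cycle_of_list (1 # ys)" by (rule two_cycle_avoidersE)
    have v: "remove1 1 (Psi n p) = xs @ ys" using w(1,3) by (simp add: remove1_append)
    have "insert 1 (set (xs @ ys)) = insert 1 {2..n}" "1 \<notin> set (xs @ ys)"
      using w(3,4) interval by auto
    moreover have "1 \<notin> {2..n}" by simp
    ultimately have "set (xs @ ys) = {2..n}" using insert_ident by metis
    then show ?thesis unfolding v using w by (auto simp: avoiders_def)
  qed
  then show "\<forall>p\<in>two_cycle_avoiders n k. cycle_of_list (take k (remove1 1 (Psi n p))) \<circ>
        cycle_of_list (1 # drop k (remove1 1 (Psi n p))) = p" by blast
  from fwd show "(\<lambda>p. remove1 1 (Psi n p)) ` two_cycle_avoiders n k \<subseteq> avoiders {2..n} k"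
    by blast
  have bwd: "p \<in> two_cycle_avoiders n k \<and> remove1 1 (Psi n p) = v"
    if v: "v \<in> avoiders {2..n} k"
      and p_def: "p = cycle_of_list (take k v) \<circ> cycle_of_list (1 # drop k v)" for p v
  proof -
    note v = avoidersD[OF v]
    have len: "length (take k v) = k" using v(5) assms by simp
    have v_split: "take k v @ drop k v = v" by simp
    have mset: "mset (take k v @ 1 # drop k v) = mset (1 # v)"
      using arg_cong[OF v_split, of mset] unfolding mset_append by simp
    have nota: "1 \<notin> set v" using v(2) by simp
    have w: "distinct (take k v @ 1 # drop k v)" "set (take k v @ 1 # drop k v) = {1..n}"
      using mset_eq_imp_distinct_iff[OF mset] mset_eq_setD[OF mset] v(1,2) nota interval by auto
    have "take k v \<noteq> []" using len assms(1) by auto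
    note p = two_cycles_of_words[OF w this v(4), folded p_def]
    have Psi: "Psi n p = take k v @ 1 # drop k v" by (simp add: Psi_def p(3))
    have "\<forall>x\<in>set (take k v) \<union> set (drop k v). 1 < x"
      using v(2) by (auto dest!: in_set_takeD in_set_dropD)
    then have "avoids_321 (Psi n p)"
      unfolding Psi using avoids_321_insert_min v(3,4) v_split by metis
    moreover have "remove1 1 (Psi n p) = v"
      unfolding Psi using nota in_set_takeD[of 1 k v] by (auto simp: remove1_append)
    ultimately show ?thesis using p len by (simp add: cyclically_avoids_321_iff)
  qed
  then show "\<forall>v\<in>avoiders {2..n} k.
      remove1 1 (Psi n (cycle_of_list (take k v) \<circ> cycle_of_list (1 # drop k v))) = v" by blast
  from bwd show "(\<lambda>v. cycle_of_list (take k v) \<circ> cycle_of_list (1 # drop k v)) ` avoiders {2..n} k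
      \<subseteq> two_cycle_avoiders n k" by blast
qed

theorem card_two_cycle_avoiders:
  assumes "0 < k"
  shows "card (two_cycle_avoiders n k) = (if k < n then ballot (n - Suc k) k else 0)"
proof (cases "k < n")
  case True
  then have "card {2..n} = n - Suc k + k" by simp
  then have "card (avoiders {2..n} k) = ballot (n - Suc k) k" by (intro card_avoiders) simp_all
  with bij_betw_same_card[OF bij_betw_two_cycle_avoiders[OF assms True]] True
  show ?thesis by simp
next
  case False
  \<comment> \<open>The first cycle and the element 1 of the second already need
    \<open>k + 1\<close> elements of \<open>{1..n}\<close>.\<close>
  have "p \<notin> two_cycle_avoiders n k" for p
  proof
    assume "p \<in> two_cycle_avoiders n k"
    then obtain xs ys where "length xs = k" "distinct (xs @ 1 # ys)" "set (xs @ 1 # ys) = {1..n}"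
      by (rule two_cycle_avoidersE)
    then have "Suc (k + length ys) = n" using distinct_card[of "xs @ 1 # ys"] by simp
    with False show False by simp
  qed
  then have "two_cycle_avoiders n k = {}" by blast
  with False show ?thesis by (simp only: card.empty if_False)
qed

text \<open>Both sides equal \<open>ballot (n - Suc k) k\<close> for \<open>k < n\<close> and 0
  otherwise.\<close>

theorem mainTheorem15:
  fixes n k :: nat
  assumes "n \<ge> 2" and "k \<ge> 1"
  shows "card {p. p permutes {1..n} \<and> card (cycle_sets n p) = 2 \<and>
                  cyclically_avoids_321 n p \<and>
                  length (hd (standard_cycle_form n p)) = k}
       = card {w. dyck_path n w \<and> first_peak_height w = int (k + 1)}"
  using card_two_cycle_avoiders[of k n] card_dyck_paths_first_peak_height[of n k] assms by simp

end
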